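(* Let $f:[0,\infty)\to\mathbb{R}_+$ be a completely monotonic function, with inverse $f^{-1}$. Let $f_1:[0,\infty)\to\mathbb{R}$ be a continuous function such that $f^{-1}\circ f_1$ is a Bernstein function. Let $C_{\mathcal{T}}:\mathbb{R}\to\mathbb{R}$ be a continuous, symmetric covariance function such that $f^{-1}\circ C_{\mathcal{T}}$ is a temporal variogram. Let $\psi_{\mathcal{S}}=f_{1,[0,\pi]}$ be the restriction of $f_1$ to the interval $[0,\pi]$. Then $$\psi(d,u)=\mathcal{Q}_f\big(\psi_{\mathcal{S}}(d),C_{\mathcal{T}}(u)\big)=f\!\left(\tfrac12 f^{-1}(\psi_{\mathcal{S}}(d))+\tfrac12 f^{-1}(C_{\mathcal{T}}(u))\right),\qquad (d,u)\in[0,\pi]\times\mathbb{R},$$ is a geodesically isotropic space-time covariance function on $\mathbb{S}^n\times\mathbb{R}$, for all $n=1,2,3,\ldots$.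
   Context: A function $f:[0,\infty)\to(0,\infty)$ is completely monotonic if it is infinitely differentiable on $(0,\infty)$ with $(-1)^j f^{(j)}(t)\ge 0$ for all $t>0$ and $j=0,1,2,\dots$; by Bernstein's theorem this means $f(t)=\int_{[0,\infty)}e^{-\xi t}\,H(d\xi)$, $t\ge0$, for a positive bounded measure $H$. The function $f$ is assumed to have a proper inverse, i.e. it is nonconstant and hence strictly decreasing, and $f^{-1}$ is defined on the range of $f$; the compositions $f^{-1}\circ f_1$ and $f^{-1}\circ C_{\mathcal{T}}$ are assumed to be well defined. The quasi arithmetic mean generated by $f$ is $\mathcal{Q}_f(x,y)=f\left(\tfrac12 f^{-1}(x)+\tfrac12 f^{-1}(y)\right)$. A Bernstein function is a continuous (here nonnegative) function on the positive real line (here on $[0,\infty)$) whose first derivative is completely monotonic, i.e. $g'\ge0$ and $(-1)^{j}(g')^{(j)}\ge0$ on $(0,\infty)$ for all $j\ge 0$. A covariance function on $\mathbb{R}$ is a function $C_{\mathcal{T}}$ with $\sum_{i,j}c_ic_jC_{\mathcal{T}}(t_i-t_j)\ge0$ for all finite collections $t_i\in\mathbb{R}$, $c_i\in\mathbb{R}$; symmetric means $C_{\mathcal{T}}(-u)=C_{\mathcal{T}}(u)$. A temporal variogram is a function $\gamma:\mathbb{R}\to[0,\infty)$ of the form $\gamma(u)=\tfrac12\mathrm{Var}(Y(t+u)-Y(t))$ for a real process $Y$ on $\mathbb{R}$; equivalently $\gamma$ is even, $\gamma(0)=0$, and $\sum_{i,j}c_ic_j\gamma(t_i-t_j)\le0$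 for all finite collections $t_i\in\mathbb{R}$ and $c_i\in\mathbb{R}$ with $\sum_i c_i=0$. $\mathbb{S}^n=\{s\in\mathbb{R}^{n+1}:\|s\|=1\}$ with $d_{\mathrm{GC}}(s_1,s_2)=\arccos\langle s_1,s_2\rangle\in[0,\pi]$. A function $\psi:[0,\pi]\times\mathbb{R}\to\mathbb{R}$ is a geodesically isotropic space-time covariance function on $\mathbb{S}^n\times\mathbb{R}$ if $\sum_{i,j=1}^N c_ic_j\,\psi(d_{\mathrm{GC}}(s_i,s_j),t_i-t_j)\ge0$ for all $N\in\mathbb{N}$, all $(s_i,t_i)\in\mathbb{S}^n\times\mathbb{R}$ and all $c_i\in\mathbb{R}$ (and the kernel is symmetric). *)

theory Defs
  imports "HOL-Probability.Probability"
begin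

text \<open>
  Functions on \<open>[0,\<infinity>)\<close> are total functions on \<^typ>\<open>real\<close>; only their values on
  \<open>{0..}\<close> matter. Iterated \<^const>\<open>deriv\<close> is only used at points \<open>t > 0\<close>, where it
  depends just on the values of the function near \<open>t\<close>. Positivity of the
  generator is not part of this predicate, since it is also applied to the derivative
  of a Bernstein function, which may vanish. Continuity at \<open>0\<close> is not required, so
  the predicate also admits functions for which Bernstein's integral representation
  holds only on \<open>t > 0\<close>.
\<close>

definition completely_monotonic :: "(real \<Rightarrow> real) \<Rightarrow> bool" where
  "completely_monotonic f \<longleftrightarrow>
     (\<forall>j. \<forall>t>0. (deriv ^^ j) f differentiable (at t)) \<and>
     (\<forall>j. \<forall>t>0. (-1) ^ j * (deriv ^^ j) f t \<ge> 0)"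

definition bernstein_function :: "(real \<Rightarrow> real) \<Rightarrow> bool" where
  "bernstein_function g \<longleftrightarrow>
     continuous_on {0..} g \<and> (\<forall>t\<ge>0. g t \<ge> 0) \<and>
     (\<forall>t>0. g differentiable (at t)) \<and> completely_monotonic (deriv g)"

text \<open>The inverse on the range of \<open>f\<close>; outside \<open>f ` {0..}\<close> its value is unspecified.\<close>

definition gen_inverse :: "(real \<Rightarrow> real) \<Rightarrow> real \<Rightarrow> real" where
  "gen_inverse f = the_inv_into {0..} f"

definition quasi_arithmetic_mean :: "(real \<Rightarrow> real) \<Rightarrow> real \<Rightarrow> real \<Rightarrow> real" where
  "quasi_arithmetic_mean f x y = f (1/2 * gen_inverse f x + 1/2 * gen_inverse f y)"

definition covariance_function :: "(real \<Rightarrow> real) \<Rightarrow> bool" where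
  "covariance_function C \<longleftrightarrow>
     (\<forall>(N::nat) (t::nat \<Rightarrow> real) (c::nat \<Rightarrow> real).
        (\<Sum>i<N. \<Sum>j<N. c i * c j * C (t i - t j)) \<ge> 0)"

text \<open>
  \<open>\<gamma>\<close> is the variogram of the real process \<open>Y\<close> on the probability space \<open>M\<close>. Square
  integrability of the increments is required explicitly because the Bochner integral of
  a non-integrable function is \<open>0\<close>, so that the variance would otherwise be meaningless.
\<close>

definition variogram_of :: "'w measure \<Rightarrow> (real \<Rightarrow> 'w \<Rightarrow> real) \<Rightarrow> (real \<Rightarrow> real) \<Rightarrow> bool" where
  "variogram_of M Y \<gamma> \<longleftrightarrow>
     prob_space M \<and> (\<forall>t. Y t \<in> borel_measurable M) \<and>
     (\<forall>t u. integrable M (\<lambda>\<omega>. (Y (t + u) \<omega> - Y t \<omega>)\<^sup>2)) \<and>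
     (\<forall>t u. \<gamma> u = 1/2 * prob_space.variance M (\<lambda>\<omega>. Y (t + u) \<omega> - Y t \<omega>))"

definition d_GC :: "'a::real_inner \<Rightarrow> 'a \<Rightarrow> real" where
  "d_GC s1 s2 = arccos (s1 \<bullet> s2)"

text \<open>
  The set \<open>S\<close> is meant to be the unit sphere; passing it as an argument determines the
  ambient space and hence the dimension. Only values \<open>\<psi> d u\<close> with \<open>d \<in> [0,\<pi>]\<close> enter.
\<close>

definition geodesically_isotropic_covariance ::
  "'a::real_inner set \<Rightarrow> (real \<Rightarrow> real \<Rightarrow> real) \<Rightarrow> bool" where
  "geodesically_isotropic_covariance S \<psi> \<longleftrightarrow>
     (\<forall>s\<in>S. \<forall>s'\<in>S. \<forall>t t'. \<psi> (d_GC s s') (t - t') = \<psi> (d_GC s' s) (t' - t)) \<and>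
     (\<forall>(N::nat) (s::nat \<Rightarrow> 'a) (t::nat \<Rightarrow> real) (c::nat \<Rightarrow> real).
        (\<forall>i<N. s i \<in> S) \<longrightarrow>
        (\<Sum>i<N. \<Sum>j<N. c i * c j * \<psi> (d_GC (s i) (s j)) (t i - t j)) \<ge> 0)"

end

theory Submission
  imports Defs
begin

text \<open>
  Put \<open>g = f\<^sup>-\<^sup>1 \<circ> f1\<close> and \<open>\<gamma> = f\<^sup>-\<^sup>1 \<circ> C\<close>. On any finite set of points of the sphere and
  of the time axis the candidate covariance is the matrix \<open>f (h i j)\<close>, where \<open>h i j\<close> is the
  average of \<open>g (d_GC (s i) (s j))\<close> and \<open>\<gamma> (t i - t j)\<close>. Three facts are needed: the geodesic
  distance and the variogram are conditionally negative definite kernels; Bernstein functions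
  preserve conditional negative definiteness; completely monotonic functions turn conditionally
  negative definite matrices into positive semidefinite ones.

  The last two facts are usually read off from the integral representations of Bernstein and
  Levy-Khintchine. A finite matrix admits a more elementary argument. If \<open>f\<close> is completely
  monotonic and \<open>a > 0\<close>, then \<open>y \<mapsto> f (a - y)\<close> has nonnegative derivatives of every order on
  \<open>[0,a)\<close>, and therefore equals its Taylor series at \<open>0\<close> there, with nonnegative coefficients
  (\<open>absolutely_monotone_sums\<close>). By the Schur product theorem such a series maps positive
  semidefinite matrices to positive semidefinite matrices entry by entry. It remains to write
  \<open>h i j\<close> as \<open>a - A i j\<close> with \<open>A\<close> positive semidefinite, and this is possible for all large \<open>a\<close>
  once an arbitrarily small positive multiple of the identity is added to \<open>- h\<close>
  (\<open>cnd_imp_psd_shift\<close>): the term \<open>a\<close> controls the direction of the constant vectors, conditional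
  negative definiteness controls its orthogonal complement, and the added multiple of the
  identity absorbs the cross terms. A limit removes the perturbation. The same argument, applied
  to \<open>y \<mapsto> g a - g (a - y)\<close>, handles Bernstein functions.

  For the distance on the sphere, \<open>arccos = \<pi>/2 - arcsin\<close>, and the power series of \<open>arcsin\<close> has
  nonnegative coefficients, so that \<open>arcsin\<close> of a Gram matrix is positive semidefinite.

  The limit that removes the perturbation requires \<open>f\<close> to be right continuous at the entries of
  \<open>h\<close>. Complete monotonicity gives this away from \<open>0\<close> only. If \<open>f\<close> jumps at \<open>0\<close>, continuity of
  \<open>f1\<close> and of \<open>C\<close> forces \<open>\<gamma>\<close> to vanish and \<open>g\<close> to be either identically \<open>0\<close> or nowhere \<open>0\<close>; then the
  matrix is constant, or \<open>h\<close> has no entry at which the jump could matter.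
\<close>

section \<open>Positive semidefinite and conditionally negative definite matrices\<close>

definition qform :: "nat \<Rightarrow> (nat \<Rightarrow> nat \<Rightarrow> real) \<Rightarrow> (nat \<Rightarrow> real) \<Rightarrow> real" where
  "qform N A c = (\<Sum>i<N. \<Sum>j<N. c i * c j * A i j)"

definition psd :: "nat \<Rightarrow> (nat \<Rightarrow> nat \<Rightarrow> real) \<Rightarrow> bool" where
  "psd N A \<longleftrightarrow> (\<forall>c. 0 \<le> qform N A c)"

definition cnd :: "nat \<Rightarrow> (nat \<Rightarrow> nat \<Rightarrow> real) \<Rightarrow> bool" where
  "cnd N h \<longleftrightarrow> (\<forall>c. (\<Sum>i<N. c i) = 0 \<longrightarrow> qform N h c \<le> 0)"

lemma qform_cong: "(\<And>i j. i < N \<Longrightarrow> j < N \<Longrightarrow> A i j = B i j) \<Longrightarrow> qform N A c = qform N B c"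
  by (simp add: qform_def)

lemma psd_cong: "(\<And>i j. i < N \<Longrightarrow> j < N \<Longrightarrow> A i j = B i j) \<Longrightarrow> psd N A = psd N B"
  using qform_cong[of N A B] by (simp add: psd_def)

lemma qform_add: "qform N (\<lambda>i j. A i j + B i j) c = qform N A c + qform N B c"
  by (simp add: qform_def algebra_simps sum.distrib)

lemma qform_diff: "qform N (\<lambda>i j. A i j - B i j) c = qform N A c - qform N B c"
  by (simp add: qform_def algebra_simps sum_subtractf)

lemma qform_scale: "qform N (\<lambda>i j. r * A i j) c = r * qform N A c"
  by (simp add: qform_def sum_distrib_left algebra_simps)

lemma qform_rank_one: "qform N (\<lambda>i j. v i * v j) c = (\<Sum>i<N. c i * v i)\<^sup>2"
  by (simp add: qform_def power2_eq_square sum_product algebra_simps)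

lemma qform_const: "qform N (\<lambda>i j. a) c = a * (\<Sum>i<N. c i)\<^sup>2"
  by (simp add: qform_def power2_eq_square sum_product sum_distrib_left algebra_simps)

lemma qform_diag: "qform N (\<lambda>i j. if i = j then d else 0) c = d * (\<Sum>i<N. (c i)\<^sup>2)"
  by (simp add: qform_def if_distrib sum.delta sum_distrib_left power2_eq_square
      mult.commute mult.left_commute cong: if_cong)

lemma psd_const: "0 \<le> a \<Longrightarrow> psd N (\<lambda>i j. a)"
  by (simp add: psd_def qform_const)

lemma cnd_average:
  assumes "cnd N g" "cnd N h"
  shows "cnd N (\<lambda>i j. (g i j + h i j) / 2)"
  unfolding cnd_def
proof (intro allI impI)
  fix c :: "nat \<Rightarrow> real" assume "(\<Sum>i<N. c i) = 0"
  then have "qform N g c \<le> 0" "qform N h c \<le> 0"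
    using assms by (simp_all add: cnd_def)
  then show "qform N (\<lambda>i j. (g i j + h i j) / 2) c \<le> 0"
    using qform_scale[of N "1/2" "\<lambda>i j. g i j + h i j" c] by (simp add: qform_add)
qed

lemma qform_Suc:
  assumes "\<And>i. i < N \<Longrightarrow> A N i = A i N"
  shows "qform (Suc N) A c
    = qform N A c + 2 * c N * (\<Sum>i<N. c i * A i N) + (c N)\<^sup>2 * A N N"
proof -
  have "(\<Sum>j<N. c N * c j * A N j) = c N * (\<Sum>i<N. c i * A i N)"
    using assms by (auto simp: sum_distrib_left intro!: sum.cong)
  moreover have "(\<Sum>i<N. c i * c N * A i N) = c N * (\<Sum>i<N. c i * A i N)"
    by (auto simp: sum_distrib_left intro!: sum.cong)
  ultimately show ?thesis
    by (simp add: qform_def sum.distrib power2_eq_square)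
qed

text \<open>
  A Cholesky factorisation, by induction on the size: subtracting the rank one matrix built from
  the last column clears the last row and column, and the Schur complement that remains is again
  positive semidefinite. With the convention \<open>x / 0 = 0\<close> the formulas also cover a vanishing last
  diagonal entry, since then the whole last column vanishes.
\<close>

lemma psd_gram:
  assumes "psd N A" and "\<And>i j. i < N \<Longrightarrow> j < N \<Longrightarrow> A i j = A j i"
  shows "\<exists>B. \<forall>i<N. \<forall>j<N. A i j = (\<Sum>k<N. B k i * B k j)"
  using assms
proof (induction N arbitrary: A)
  case 0
  then show ?case by simp
next
  case (Suc N)
  define p where "p = A N N"
  define A' where "A' = (\<lambda>i j. A i j - A i N * A j N / p)"
  have sym: "A N i = A i N" if "i < N" for i
    using Suc.prems(2)[of N i] that by simp
  have qS: "qform (Suc N) A c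
      = qform N A c + 2 * c N * (\<Sum>i<N. c i * A i N) + (c N)\<^sup>2 * A N N" for c
    using sym by (rule qform_Suc)
  have pos: "0 \<le> qform (Suc N) A c" for c
    using Suc.prems(1) by (simp add: psd_def)
  have p0: "0 \<le> p"
    using pos[of "\<lambda>i. if i = N then 1 else 0"] unfolding qS by (simp add: qform_def p_def)
  have zero: "A i N = 0" if "i < N" "p = 0" for i
  proof (rule ccontr)
    assume ne: "A i N \<noteq> 0"
    \<comment> \<open>On the vector with entry \<open>1\<close> at \<open>i\<close> and \<open>s\<close> at \<open>N\<close> the form takes the value \<open>-1\<close>.\<close>
    define s where "s = - (A i i + 1) / (2 * A i N)"
    define c where "c = (\<lambda>k. if k = N then s else if k = i then 1 else (0::real))"
    have "qform N A c = A i i"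
    proof -
      have "qform N A c = (\<Sum>k<N. \<Sum>j<N. if k = i then if j = i then A k j else 0 else 0)"
        unfolding qform_def by (intro sum.cong refl) (auto simp: c_def)
      also have "\<dots> = (\<Sum>k<N. if k = i then A k i else 0)"
        using that by (intro sum.cong refl) (auto simp: sum.delta)
      also have "\<dots> = A i i" using that by (simp add: sum.delta)
      finally show ?thesis .
    qed
    moreover have "(\<Sum>k<N. c k * A k N) = A i N" "c N = s" "A N N = 0"
    proof -
      have "(\<Sum>k<N. c k * A k N) = (\<Sum>k<N. if k = i then A k N else 0)"
        by (intro sum.cong refl) (auto simp: c_def)
      then show "(\<Sum>k<N. c k * A k N) = A i N" using that by (simp add: sum.delta)
    qed (use that in \<open>simp_all add: c_def p_def\<close>)
    ultimately have "0 \<le> A i i + 2 * s * A i N"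
      using pos[of c] unfolding qS by simp
    also have "2 * s * A i N = - (A i i + 1)" using ne by (simp add: s_def)
    finally show False by simp
  qed
  have "psd N A'"
    unfolding psd_def
  proof
    fix c
    define S where "S = (\<Sum>i<N. c i * A i N)"
    \<comment> \<open>The last coordinate that minimises the quadratic form when the others are fixed.\<close>
    define c' where "c' = c(N := - S / p)"
    have "qform N A c' = qform N A c" "(\<Sum>i<N. c' i * A i N) = S"
      by (simp_all add: qform_def S_def c'_def)
    then have "0 \<le> qform N A c + 2 * (- S / p) * S + (- S / p)\<^sup>2 * p"
      using pos[of c'] unfolding qS by (simp add: c'_def p_def)
    also have "\<dots> = qform N A c - S\<^sup>2 / p"
      by (cases "p = 0") (simp_all add: power2_eq_square field_simps)
    also have "S\<^sup>2 / p = qform N (\<lambda>i j. (1 / p) * (A i N * A j N)) c"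
      by (simp only: qform_scale qform_rank_one) (simp add: S_def)
    finally show "0 \<le> qform N A' c"
      unfolding A'_def by (simp add: qform_diff)
  qed
  moreover have "A' i j = A' j i" if "i < N" "j < N" for i j
    using Suc.prems(2)[of i j] that by (simp add: A'_def)
  ultimately obtain B where B: "\<forall>i<N. \<forall>j<N. A' i j = (\<Sum>k<N. B k i * B k j)"
    using Suc.IH by blast
  define B' where "B' = (\<lambda>k i. if k < N then (if i < N then B k i else 0) else A i N / sqrt p)"
  have "A i j = (\<Sum>k<Suc N. B' k i * B' k j)" if ij: "i < Suc N" "j < Suc N" for i j
  proof -
    have last: "B' N i * B' N j = A i N * A j N / p"
      using p0 by (simp add: B'_def)
    consider "i < N" "j < N" | "i = N \<or> j = N" using ij by linarith
    then show ?thesis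
    proof cases
      case 1
      then have "(\<Sum>k<N. B' k i * B' k j) = A' i j"
        using B by (simp add: B'_def)
      with last show ?thesis by (simp add: A'_def)
    next
      case 2
      then have "(\<Sum>k<N. B' k i * B' k j) = 0"
        by (auto simp: B'_def)
      moreover have "A i N * A j N / p = A i j"
        using 2 ij zero[of i] zero[of j] sym[of i] sym[of j]
        by (cases "p = 0"; cases "i = N"; cases "j = N") (auto simp: p_def)
      ultimately show ?thesis using last by simp
    qed
  qed
  then show ?case by blast
qed

text \<open>
  With \<open>A\<close> a Gram matrix, the form of the entrywise product at \<open>c\<close> is the sum over the rows \<open>B k\<close>
  of the form of \<open>P\<close> at the entrywise product of \<open>c\<close> and \<open>B k\<close>.
\<close>

lemma psd_Schur:
  assumes A: "psd N A" "\<And>i j. i < N \<Longrightarrow> j < N \<Longrightarrow> A i j = A j i" and P: "psd N P"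
  shows "psd N (\<lambda>i j. A i j * P i j)"
  unfolding psd_def
proof
  fix c
  obtain B where B: "\<forall>i<N. \<forall>j<N. A i j = (\<Sum>k<N. B k i * B k j)"
    using psd_gram[OF A] by blast
  have "qform N (\<lambda>i j. A i j * P i j) c
      = (\<Sum>i<N. \<Sum>j<N. \<Sum>k<N. (c i * B k i) * (c j * B k j) * P i j)"
    unfolding qform_def using B
    by (intro sum.cong refl) (simp add: sum_distrib_left sum_distrib_right algebra_simps)
  also have "\<dots> = (\<Sum>i<N. \<Sum>k<N. \<Sum>j<N. (c i * B k i) * (c j * B k j) * P i j)"
    by (intro sum.cong refl sum.swap)
  also have "\<dots> = (\<Sum>k<N. qform N P (\<lambda>i. c i * B k i))"
    unfolding qform_def by (rule sum.swap)
  also have "\<dots> \<ge> 0"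
    using P by (intro sum_nonneg) (simp add: psd_def)
  finally show "0 \<le> qform N (\<lambda>i j. A i j * P i j) c" .
qed

lemma psd_power:
  assumes "psd N A" "\<And>i j. i < N \<Longrightarrow> j < N \<Longrightarrow> A i j = A j i"
  shows "psd N (\<lambda>i j. A i j ^ k)"
  by (induction k) (simp_all add: psd_const psd_Schur[OF assms])

lemma psd_power_series:
  assumes A: "psd N A" "\<And>i j. i < N \<Longrightarrow> j < N \<Longrightarrow> A i j = A j i"
    and a: "\<And>k. 0 \<le> a k"
    and F: "\<And>i j. i < N \<Longrightarrow> j < N \<Longrightarrow> (\<lambda>k. a k * A i j ^ k) sums F i j"
  shows "psd N F"
  unfolding psd_def
proof
  fix c
  have sums: "(\<lambda>k. qform N (\<lambda>i j. a k * A i j ^ k) c) sums qform N F c"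
    unfolding qform_def using F by (intro sums_sum sums_mult) auto
  have "0 \<le> qform N (\<lambda>i j. a k * A i j ^ k) c" for k
    using psd_power[OF A, of k] a[of k] by (simp add: qform_scale psd_def)
  then show "0 \<le> qform N F c"
    by (rule sums_le[OF _ sums_zero sums])
qed

lemma tendsto_qform:
  assumes "\<And>i j. i < N \<Longrightarrow> j < N \<Longrightarrow> ((\<lambda>x. A x i j) \<longlongrightarrow> L i j) \<F>"
  shows "((\<lambda>x. qform N (A x) c) \<longlongrightarrow> qform N L c) \<F>"
  unfolding qform_def using assms by (intro tendsto_sum tendsto_mult tendsto_const) auto

lemma psd_limit:
  assumes "\<F> \<noteq> bot" "\<forall>\<^sub>F x in \<F>. psd N (A x)"
    and "\<And>i j. i < N \<Longrightarrow> j < N \<Longrightarrow> ((\<lambda>x. A x i j) \<longlongrightarrow> L i j) \<F>"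
  shows "psd N L"
  unfolding psd_def
proof
  fix c
  have "\<forall>\<^sub>F x in \<F>. 0 \<le> qform N (A x) c"
    using assms(2) by (rule eventually_mono) (simp add: psd_def)
  moreover have "((\<lambda>x. qform N (A x) c) \<longlongrightarrow> qform N L c) \<F>"
    by (intro tendsto_qform assms(3))
  ultimately show "0 \<le> qform N L c"
    using assms(1) by (intro tendsto_lowerbound)
qed

text \<open>
  Split \<open>c\<close> into a constant vector and a vector \<open>e\<close> of zero sum. The form of \<open>h\<close> is nonpositive at
  \<open>e\<close>; the cross term is linear in \<open>e\<close> and Young's inequality bounds it by \<open>d\<close> times the squared
  length of \<open>e\<close> plus a multiple of the square of the sum of \<open>c\<close>; what is left is such a multiple
  as well, and a large \<open>a\<close> dominates both. Positivity of \<open>d\<close> matters: for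
  \<open>h i j = i + j\<close>, whose form vanishes at all vectors of zero sum, no \<open>a\<close> suffices with \<open>d = 0\<close>.
\<close>

lemma cnd_imp_psd_shift:
  assumes h: "cnd N h" and d: "0 < d"
  shows "\<exists>a0. \<forall>a\<ge>a0. psd N (\<lambda>i j. a - h i j + (if i = j then d else 0))"
proof (cases "N = 0")
  case True
  then show ?thesis by (simp add: psd_def qform_def)
next
  case False
  then have N: "0 < real N" by simp
  define v where "v = (\<lambda>j. (\<Sum>i<N. h i j + h j i) / N)"
  define H where "H = qform N h (\<lambda>_. 1) / (real N)\<^sup>2"
  define a0 where "a0 = H + (\<Sum>j<N. (v j)\<^sup>2) / (4 * d)"
  have "psd N (\<lambda>i j. a - h i j + (if i = j then d else 0))" if a: "a \<ge> a0" for a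
    unfolding psd_def
  proof
    fix c :: "nat \<Rightarrow> real"
    define s where "s = (\<Sum>i<N. c i)"
    define e where "e = (\<lambda>i. c i - s / N)"
    have c: "c = (\<lambda>i. e i + s / N)" by (simp add: e_def)
    have e0: "(\<Sum>i<N. e i) = 0"
      using N by (simp add: e_def s_def sum_subtractf)
    have cross: "(\<Sum>i<N. \<Sum>j<N. e i * h i j) + (\<Sum>i<N. \<Sum>j<N. e j * h i j) = N * (\<Sum>j<N. e j * v j)"
    proof -
      have "(\<Sum>i<N. \<Sum>j<N. e j * h i j) = (\<Sum>j<N. \<Sum>i<N. e j * h i j)"
        by (rule sum.swap)
      moreover have "N * (\<Sum>j<N. e j * v j) = (\<Sum>j<N. e j * (\<Sum>i<N. h i j + h j i))"
        unfolding sum_distrib_left[of "real N"] v_def using N by (intro sum.cong refl) simp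
      ultimately show ?thesis
        by (simp add: sum_distrib_left sum.distrib distrib_left)
    qed
    have "qform N h c = qform N h e
        + (s / N) * ((\<Sum>i<N. \<Sum>j<N. e i * h i j) + (\<Sum>i<N. \<Sum>j<N. e j * h i j))
        + (s / N)\<^sup>2 * qform N h (\<lambda>_. 1)"
      unfolding c qform_def
      by (simp only: sum_distrib_left sum.distrib[symmetric] distrib_left)
         (intro sum.cong refl, simp add: algebra_simps power2_eq_square)
    also have "\<dots> = qform N h e + s * (\<Sum>j<N. e j * v j) + s\<^sup>2 * H"
      unfolding cross using N by (simp add: H_def power_divide)
    finally have qc: "qform N h c = qform N h e + s * (\<Sum>j<N. e j * v j) + s\<^sup>2 * H" .
    have he: "qform N h e \<le> 0"
      using h e0 by (simp add: cnd_def)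
    have young: "s * (e j * v j) \<le> s\<^sup>2 * (v j)\<^sup>2 / (4 * d) + d * (e j)\<^sup>2" for j
    proof -
      have "0 \<le> (s * v j - 2 * d * e j)\<^sup>2 / (4 * d)" using d by simp
      also have "\<dots> = s\<^sup>2 * (v j)\<^sup>2 / (4 * d) + d * (e j)\<^sup>2 - s * (e j * v j)"
        using d by (simp add: field_simps power2_eq_square)
      finally show ?thesis by simp
    qed
    have "s * (\<Sum>j<N. e j * v j) \<le> (\<Sum>j<N. s\<^sup>2 * (v j)\<^sup>2 / (4 * d) + d * (e j)\<^sup>2)"
      unfolding sum_distrib_left by (intro sum_mono young)
    also have "\<dots> = s\<^sup>2 * ((\<Sum>j<N. (v j)\<^sup>2) / (4 * d)) + d * (\<Sum>j<N. (e j)\<^sup>2)"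
      by (simp add: sum.distrib sum_distrib_left sum_divide_distrib)
    finally have cr: "s * (\<Sum>j<N. e j * v j)
        \<le> s\<^sup>2 * ((\<Sum>j<N. (v j)\<^sup>2) / (4 * d)) + d * (\<Sum>j<N. (e j)\<^sup>2)" .
    have "(\<Sum>j<N. (c j)\<^sup>2) = (\<Sum>j<N. (e j)\<^sup>2) + 2 * (s / N) * (\<Sum>j<N. e j) + N * (s / N)\<^sup>2"
      unfolding c
      by (simp add: power2_sum sum.distrib sum_distrib_left sum_divide_distrib algebra_simps)
    then have "(\<Sum>j<N. (e j)\<^sup>2) \<le> (\<Sum>j<N. (c j)\<^sup>2)"
      using e0 by simp
    then have norm: "d * (\<Sum>j<N. (e j)\<^sup>2) \<le> d * (\<Sum>j<N. (c j)\<^sup>2)"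
      using d by simp
    have "qform N h c \<le> s\<^sup>2 * a0 + d * (\<Sum>j<N. (e j)\<^sup>2)"
      using qc he cr by (simp add: a0_def algebra_simps)
    also have "s\<^sup>2 * a0 \<le> a * s\<^sup>2"
      using mult_right_mono[OF a, of "s\<^sup>2"] by (simp add: mult.commute)
    finally have "qform N h c \<le> a * s\<^sup>2 + d * (\<Sum>j<N. (c j)\<^sup>2)"
      using norm by simp
    then show "0 \<le> qform N (\<lambda>i j. a - h i j + (if i = j then d else 0)) c"
      by (simp add: qform_add qform_diff qform_const qform_diag s_def)
  qed
  then show ?thesis by blast
qed

section \<open>Absolutely monotone functions of matrix entries\<close>

text \<open>
  The family \<open>\<phi>\<close> lists a function and its successive derivatives, so that no iterated \<open>deriv\<close> of a
  reflected function has to be computed.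
\<close>

definition taylor_rem :: "nat \<Rightarrow> (nat \<Rightarrow> real \<Rightarrow> real) \<Rightarrow> real \<Rightarrow> real" where
  "taylor_rem n \<phi> y = \<phi> 0 y - (\<Sum>k<n. \<phi> k 0 / fact k * y ^ k)"

lemma taylor_rem_zero: "taylor_rem (Suc n) \<phi> 0 = 0"
  by (simp add: taylor_rem_def sum.lessThan_Suc_shift del: sum.lessThan_Suc)

lemma DERIV_taylor_rem:
  assumes "(\<phi> 0 has_real_derivative \<phi> (Suc 0) y) (at y)"
  shows "(taylor_rem (Suc n) \<phi> has_real_derivative taylor_rem n (\<lambda>k. \<phi> (Suc k)) y) (at y)"
proof -
  have eq: "taylor_rem (Suc n) \<phi> = (\<lambda>y. \<phi> 0 y - (\<phi> 0 0 + (\<Sum>k<n. \<phi> (Suc k) 0 / fact (Suc k) * y ^ Suc k)))"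
    by (rule ext) (simp add: taylor_rem_def sum.lessThan_Suc_shift del: sum.lessThan_Suc fact_Suc power_Suc)
  have D: "((\<lambda>y. \<phi> (Suc k) 0 / fact (Suc k) * y ^ Suc k) has_real_derivative
      \<phi> (Suc k) 0 / fact k * y ^ k) (at y)" for k
    by (rule derivative_eq_intros refl)+ (simp add: field_simps del: of_nat_Suc)
  show ?thesis
    unfolding eq taylor_rem_def
    by (rule derivative_eq_intros assms D refl)+ simp
qed

text \<open>
  The second inequality says that \<open>taylor_rem n \<phi> y / y ^ n\<close> increases with \<open>y\<close>. Both are obtained
  together by induction: differentiation lowers the order of the remainder by one, so that
  the hypothesis for the derivative is integrated from \<open>0\<close>, where the remainder vanishes.
\<close>

lemma taylor_rem_scaling:
  assumes "\<And>k y. 0 \<le> y \<Longrightarrow> y < b \<Longrightarrow> (\<phi> k has_real_derivative \<phi> (Suc k) y) (at y)"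
    and "\<And>k y. 0 \<le> y \<Longrightarrow> y < b \<Longrightarrow> 0 \<le> \<phi> k y"
    and "0 \<le> r" "r \<le> 1" "0 \<le> y" "y < b"
  shows "0 \<le> taylor_rem n \<phi> y \<and> taylor_rem n \<phi> (r * y) \<le> r ^ n * taylor_rem n \<phi> y"
  using assms
proof (induction n arbitrary: \<phi> y)
  case 0
  have "r * y \<le> y" using 0 by (simp add: mult_left_le_one_le)
  then have "\<phi> 0 (r * y) \<le> \<phi> 0 y"
  proof (rule DERIV_nonneg_imp_nondecreasing)
    fix x assume "r * y \<le> x" "x \<le> y"
    moreover have "0 \<le> r * y" "y < b" using 0 by auto
    ultimately have "0 \<le> x" "x < b" by linarith+
    then show "\<exists>z. (\<phi> 0 has_real_derivative z) (at x) \<and> 0 \<le> z"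
      using "0.prems"(1,2) by blast
  qed
  then show ?case using 0 by (simp add: taylor_rem_def)
next
  case (Suc n)
  let ?R = "taylor_rem (Suc n) \<phi>" and ?S = "taylor_rem n (\<lambda>k. \<phi> (Suc k))"
  have IH: "0 \<le> ?S x \<and> ?S (r * x) \<le> r ^ n * ?S x" if "0 \<le> x" "x < b" for x
    using Suc.prems that by (intro Suc.IH) auto
  have D: "(?R has_real_derivative ?S x) (at x)" if "0 \<le> x" "x < b" for x
    using Suc.prems that by (intro DERIV_taylor_rem) auto
  have "?R 0 \<le> ?R y"
  proof (rule DERIV_nonneg_imp_nondecreasing[where f = ?R])
    show "0 \<le> y" using Suc by simp
    show "\<exists>z. (?R has_real_derivative z) (at x) \<and> 0 \<le> z" if "0 \<le> x" "x \<le> y" for x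
      using D[of x] IH[of x] that Suc.prems by auto
  qed
  moreover
  let ?G = "\<lambda>x. r ^ Suc n * ?R x - ?R (r * x)"
  have "?G 0 \<le> ?G y"
  proof (rule DERIV_nonneg_imp_nondecreasing[where f = ?G])
    show "0 \<le> y" using Suc by simp
    fix x assume x: "0 \<le> x" "x \<le> y"
    then have xb: "x < b" and rx: "0 \<le> r * x" "r * x < b"
      using Suc.prems mult_left_le_one_le[of x r] by auto
    have "((\<lambda>x. ?R (r * x)) has_real_derivative ?S (r * x) * r) (at x)"
      by (rule DERIV_chain2[where f = ?R and g = "\<lambda>x. r * x", OF D[OF rx]]) (rule derivative_eq_intros refl | simp)+
    then have "(?G has_real_derivative r ^ Suc n * ?S x - ?S (r * x) * r) (at x)"
      by (intro DERIV_diff DERIV_cmult D x xb)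
    moreover have "?S (r * x) * r \<le> r ^ Suc n * ?S x"
      using mult_right_mono[of "?S (r * x)" "r ^ n * ?S x" r] IH[OF x(1) xb] Suc.prems(3)
      by (simp add: algebra_simps)
    ultimately show "\<exists>z. (?G has_real_derivative z) (at x) \<and> 0 \<le> z"
      by (intro exI conjI) auto
  qed
  ultimately show ?case by (simp add: taylor_rem_zero)
qed

text \<open>
  Comparing \<open>y\<close> with a point \<open>z\<close> strictly between \<open>y\<close> and \<open>b\<close>, the remainder at \<open>y\<close> is at most
  \<open>(y / z) ^ n\<close> times the remainder at \<open>z\<close>, which is bounded by \<open>\<phi> 0 z\<close>. This is Bernstein's theorem
  on the analyticity of absolutely monotone functions.
\<close>

lemma absolutely_monotone_sums:
  assumes D: "\<And>k y. 0 \<le> y \<Longrightarrow> y < b \<Longrightarrow> (\<phi> k has_real_derivative \<phi> (Suc k) y) (at y)"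
    and nn: "\<And>k y. 0 \<le> y \<Longrightarrow> y < b \<Longrightarrow> 0 \<le> \<phi> k y"
    and y: "0 \<le> y" "y < b"
  shows "(\<lambda>k. \<phi> k 0 / fact k * y ^ k) sums \<phi> 0 y"
proof -
  define z where "z = (y + b) / 2"
  define r where "r = y / z"
  have z: "0 < z" "y < z" "z < b" using y by (auto simp: z_def)
  then have r: "0 \<le> r" "r < 1" "r * z = y" using y by (auto simp: r_def)
  note scaling = taylor_rem_scaling[where \<phi> = \<phi> and b = b, OF D nn]
  have lo: "0 \<le> taylor_rem n \<phi> y" for n
    using scaling[of r y n] y r by auto
  have up: "taylor_rem n \<phi> y \<le> r ^ n * \<phi> 0 z" for n
  proof -
    have "taylor_rem n \<phi> y \<le> r ^ n * taylor_rem n \<phi> z"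
      using scaling[of r z n] r z by auto
    also have "taylor_rem n \<phi> z \<le> \<phi> 0 z"
      unfolding taylor_rem_def using z nn[of 0] y by (auto intro!: sum_nonneg)
    then have "r ^ n * taylor_rem n \<phi> z \<le> r ^ n * \<phi> 0 z"
      using r by (intro mult_left_mono) auto
    finally show ?thesis .
  qed
  have "(\<lambda>n. r ^ n * \<phi> 0 z) \<longlonglongrightarrow> 0"
    using r by (intro tendsto_mult_left_zero LIMSEQ_realpow_zero) auto
  then have "(\<lambda>n. taylor_rem n \<phi> y) \<longlonglongrightarrow> 0"
  proof (rule real_tendsto_sandwich[OF _ _ tendsto_const, rotated 2])
    show "\<forall>\<^sub>F n in sequentially. 0 \<le> taylor_rem n \<phi> y"
      using lo by simp
    show "\<forall>\<^sub>F n in sequentially. taylor_rem n \<phi> y \<le> r ^ n * \<phi> 0 z"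
      using up by simp
  qed
  then have "(\<lambda>n. \<phi> 0 y - taylor_rem n \<phi> y) \<longlonglongrightarrow> \<phi> 0 y - 0"
    by (intro tendsto_diff tendsto_const)
  then show ?thesis by (simp add: sums_def taylor_rem_def)
qed

lemma psd_absolutely_monotone:
  assumes D: "\<And>k y. 0 \<le> y \<Longrightarrow> y < b \<Longrightarrow> (\<phi> k has_real_derivative \<phi> (Suc k) y) (at y)"
    and nn: "\<And>k y. 0 \<le> y \<Longrightarrow> y < b \<Longrightarrow> 0 \<le> \<phi> k y"
    and A: "psd N A" "\<And>i j. i < N \<Longrightarrow> j < N \<Longrightarrow> A i j = A j i"
    and range: "\<And>i j. i < N \<Longrightarrow> j < N \<Longrightarrow> 0 \<le> A i j \<and> A i j < b"
  shows "psd N (\<lambda>i j. \<phi> 0 (A i j))"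
proof (cases "N = 0")
  case True
  then show ?thesis by (simp add: psd_def qform_def)
next
  case False
  then have b: "0 < b" using range[of 0 0] by auto
  note sums = absolutely_monotone_sums[where \<phi> = \<phi> and b = b, OF D nn]
  show ?thesis
  proof (rule psd_power_series[OF A])
    show "0 \<le> \<phi> k 0 / fact k" for k
      using nn[of 0 k] b by auto
    show "(\<lambda>k. \<phi> k 0 / fact k * A i j ^ k) sums \<phi> 0 (A i j)" if "i < N" "j < N" for i j
      using sums range[OF that] by blast
  qed
qed

section \<open>Completely monotonic and Bernstein functions of matrix entries\<close>

text \<open>
  A perturbation of \<open>h\<close> that serves two purposes: the constant \<open>d\<close> makes every entry positive, hence
  a point at which a completely monotonic function is smooth, and subtracting \<open>d / 2\<close> on the
  diagonal supplies the multiple of the identity that \<open>cnd_imp_psd_shift\<close> consumes. The diagonal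
  stays positive because only half of \<open>d\<close> is taken back.
\<close>

definition lift_kernel :: "real \<Rightarrow> (nat \<Rightarrow> nat \<Rightarrow> real) \<Rightarrow> nat \<Rightarrow> nat \<Rightarrow> real" where
  "lift_kernel d h i j = h i j + d - (if i = j then d / 2 else 0)"

lemma lift_kernel_pos: "0 < d \<Longrightarrow> 0 \<le> h i j \<Longrightarrow> 0 < lift_kernel d h i j"
  by (auto simp: lift_kernel_def)

lemma lift_kernel_tendsto:
  assumes "0 \<le> h i j" and "(q \<longlongrightarrow> q (h i j)) (at_right (h i j))"
  shows "((\<lambda>d. q (lift_kernel d h i j)) \<longlongrightarrow> q (h i j)) (at_right 0)"
proof (rule filterlim_compose[OF assms(2)])
  have "((\<lambda>d. lift_kernel d h i j) \<longlongrightarrow> h i j) (at_right 0)"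
    unfolding lift_kernel_def by (cases "i = j") (auto intro!: tendsto_eq_intros)
  moreover have "\<forall>\<^sub>F d in at_right 0. h i j < lift_kernel d h i j"
    using eventually_at_right_less[of "0::real"]
    by (rule eventually_mono) (auto simp: lift_kernel_def)
  ultimately show "filterlim (\<lambda>d. lift_kernel d h i j) (at_right (h i j)) (at_right 0)"
    by (auto simp: filterlim_at elim: eventually_mono)
qed

lemma lift_kernel_complement:
  assumes h: "cnd N h" "\<And>i j. i < N \<Longrightarrow> j < N \<Longrightarrow> 0 \<le> h i j" and d: "0 < d"
  obtains a where "0 < a" "psd N (\<lambda>i j. a - lift_kernel d h i j)"
    "\<And>i j. i < N \<Longrightarrow> j < N \<Longrightarrow> lift_kernel d h i j \<le> a"
proof -
  obtain a0 where a0: "\<And>a. a \<ge> a0 \<Longrightarrow> psd N (\<lambda>i j. a - h i j + (if i = j then d / 2 else 0))"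
    using cnd_imp_psd_shift[OF h(1), of "d / 2"] d by auto
  \<comment> \<open>The sum of all entries serves as a crude upper bound for each of them.\<close>
  define m where "m = (\<Sum>i<N. \<Sum>j<N. h i j)"
  define a where "a = \<bar>a0\<bar> + m + d"
  have m: "h i j \<le> m" if "i < N" "j < N" for i j
  proof -
    have "h i j \<le> (\<Sum>j<N. h i j)"
      using that h(2) by (intro member_le_sum) auto
    also have "\<dots> \<le> m"
      unfolding m_def using that h(2)
      by (intro member_le_sum[of i "{..<N}" "\<lambda>i. \<Sum>j<N. h i j"]) (auto intro!: sum_nonneg)
    finally show ?thesis .
  qed
  have "0 \<le> m" unfolding m_def using h(2) by (auto intro!: sum_nonneg)
  show thesis
  proof
    show "0 < a" using d \<open>0 \<le> m\<close> by (simp add: a_def)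
    have "(\<lambda>i j. a - lift_kernel d h i j) = (\<lambda>i j. (a - d) - h i j + (if i = j then d / 2 else 0))"
      by (intro ext) (simp add: lift_kernel_def)
    then show "psd N (\<lambda>i j. a - lift_kernel d h i j)"
      using a0[of "a - d"] \<open>0 \<le> m\<close> by (simp add: a_def)
    show "lift_kernel d h i j \<le> a" if "i < N" "j < N" for i j
      using m[OF that] d by (auto simp: lift_kernel_def a_def)
  qed
qed

lemma completely_monotonic_DERIV:
  assumes "completely_monotonic f" "0 < t"
  shows "((deriv ^^ k) f has_real_derivative (deriv ^^ Suc k) f t) (at t)"
  using assms by (auto simp: completely_monotonic_def DERIV_deriv_iff_real_differentiable)

text \<open>
  Reflection turns alternating signs of the derivatives into constant ones.
\<close>

lemma completely_monotonic_reflect: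
  assumes "completely_monotonic f" "y < a"
  shows "((\<lambda>y. (-1) ^ k * (deriv ^^ k) f (a - y)) has_real_derivative
      (-1) ^ Suc k * (deriv ^^ Suc k) f (a - y)) (at y)"
proof -
  have "((\<lambda>y. (deriv ^^ k) f (a - y)) has_real_derivative (deriv ^^ Suc k) f (a - y) * (-1)) (at y)"
    using assms by (intro DERIV_chain2[OF completely_monotonic_DERIV]) (auto intro!: derivative_eq_intros)
  from DERIV_cmult[OF this, of "(-1) ^ k"] show ?thesis by (simp add: algebra_simps)
qed

text \<open>
  Schoenberg's theorem for finite matrices. Right continuity at the entries is what the
  passage from the perturbed kernel to \<open>h\<close> uses; it is automatic at positive entries.
\<close>

lemma psd_completely_monotonic:
  assumes f: "completely_monotonic f"
    and h: "cnd N h" "\<And>i j. i < N \<Longrightarrow> j < N \<Longrightarrow> 0 \<le> h i j"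
      "\<And>i j. i < N \<Longrightarrow> j < N \<Longrightarrow> h i j = h j i"
    and lim: "\<And>i j. i < N \<Longrightarrow> j < N \<Longrightarrow> (f \<longlongrightarrow> f (h i j)) (at_right (h i j))"
  shows "psd N (\<lambda>i j. f (h i j))"
proof (rule psd_limit)
  show "at_right (0::real) \<noteq> bot" by simp
  show "\<forall>\<^sub>F d in at_right 0. psd N (\<lambda>i j. f (lift_kernel d h i j))"
    using eventually_at_right_less[of "0::real"]
  proof (rule eventually_mono)
    fix d :: real assume d: "0 < d"
    obtain a where a: "0 < a" "psd N (\<lambda>i j. a - lift_kernel d h i j)"
        "\<And>i j. i < N \<Longrightarrow> j < N \<Longrightarrow> lift_kernel d h i j \<le> a"
      using lift_kernel_complement[OF h(1,2) d] by metis
    define \<phi> where "\<phi> = (\<lambda>k y. (-1) ^ k * (deriv ^^ k) f (a - y))"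
    have "psd N (\<lambda>i j. \<phi> 0 (a - lift_kernel d h i j))"
    proof (rule psd_absolutely_monotone[where b = a and \<phi> = \<phi>])
      show "(\<phi> k has_real_derivative \<phi> (Suc k) y) (at y)" if "0 \<le> y" "y < a" for k y
        unfolding \<phi>_def by (rule completely_monotonic_reflect[OF f that(2)])
      show "0 \<le> \<phi> k y" if "0 \<le> y" "y < a" for k y
        using f that unfolding completely_monotonic_def \<phi>_def by simp
      show "0 \<le> a - lift_kernel d h i j \<and> a - lift_kernel d h i j < a" if "i < N" "j < N" for i j
        using a(3)[OF that] lift_kernel_pos[of d h i j] d h(2)[OF that] by simp
    qed (use a(2) h(3) in \<open>simp_all add: lift_kernel_def\<close>)
    then show "psd N (\<lambda>i j. f (lift_kernel d h i j))" by (simp add: \<phi>_def)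
  qed
  show "((\<lambda>d. f (lift_kernel d h i j)) \<longlongrightarrow> f (h i j)) (at_right 0)" if "i < N" "j < N" for i j
    using h(2)[OF that] lim[OF that] by (rule lift_kernel_tendsto[where q = f])
qed

lemma bernstein_reflect:
  fixes a :: real and g :: "real \<Rightarrow> real"
  defines "\<phi> \<equiv> \<lambda>k y. if k = 0 then g a - g (a - y)
    else (-1) ^ (k - 1) * (deriv ^^ (k - 1)) (deriv g) (a - y)"
  assumes g: "bernstein_function g"
  shows "0 \<le> y \<Longrightarrow> y < a \<Longrightarrow> (\<phi> k has_real_derivative \<phi> (Suc k) y) (at y)"
    and "0 \<le> y \<Longrightarrow> y < a \<Longrightarrow> 0 \<le> \<phi> k y"
proof -
  have cm: "completely_monotonic (deriv g)" using g by (simp add: bernstein_function_def)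
  have D: "(\<phi> k has_real_derivative \<phi> (Suc k) y) (at y)" if "0 \<le> y" "y < a" for k y
  proof (cases k)
    case 0
    have "(g has_real_derivative deriv g (a - y)) (at (a - y))"
      using g that by (simp add: bernstein_function_def DERIV_deriv_iff_real_differentiable)
    then have "((\<lambda>y. g (a - y)) has_real_derivative deriv g (a - y) * (-1)) (at y)"
      by (rule DERIV_chain2) (auto intro!: derivative_eq_intros)
    from DERIV_diff[OF DERIV_const[of "g a"] this] show ?thesis
      using 0 by (simp add: \<phi>_def)
  next
    case (Suc m)
    then show ?thesis
      using completely_monotonic_reflect[OF cm \<open>y < a\<close>, of m] by (simp add: \<phi>_def)
  qed
  have S: "0 \<le> \<phi> (Suc k) y" if "y < a" for k y
    using cm that by (simp add: \<phi>_def completely_monotonic_def)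
  show "(\<phi> k has_real_derivative \<phi> (Suc k) y) (at y)" if "0 \<le> y" "y < a"
    using D that .
  show "0 \<le> \<phi> k y" if y: "0 \<le> y" "y < a"
  proof (cases k)
    case 0
    have "\<phi> 0 0 \<le> \<phi> 0 y"
    proof (rule DERIV_nonneg_imp_nondecreasing[OF y(1)])
      show "\<exists>z. (\<phi> 0 has_real_derivative z) (at x) \<and> 0 \<le> z" if "0 \<le> x" "x \<le> y" for x
        using D[of x 0] S[of x 0] that y by auto
    qed
    then show ?thesis using 0 by (simp add: \<phi>_def)
  next
    case (Suc m)
    then show ?thesis using S y by simp
  qed
qed

text \<open>
  The function \<open>y \<mapsto> g a - g (a - y)\<close> is absolutely monotone, and on vectors of zero sum the
  constant \<open>g a\<close> contributes nothing to the quadratic form.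
\<close>

lemma cnd_bernstein:
  assumes g: "bernstein_function g"
    and h: "cnd N h" "\<And>i j. i < N \<Longrightarrow> j < N \<Longrightarrow> 0 \<le> h i j"
      "\<And>i j. i < N \<Longrightarrow> j < N \<Longrightarrow> h i j = h j i"
  shows "cnd N (\<lambda>i j. g (h i j))"
  unfolding cnd_def
proof (intro allI impI)
  fix c :: "nat \<Rightarrow> real" assume c: "(\<Sum>i<N. c i) = 0"
  have le: "qform N (\<lambda>i j. g (lift_kernel d h i j)) c \<le> 0" if d: "0 < d" for d
  proof -
    obtain a where a: "0 < a" "psd N (\<lambda>i j. a - lift_kernel d h i j)"
        "\<And>i j. i < N \<Longrightarrow> j < N \<Longrightarrow> lift_kernel d h i j \<le> a"
      using lift_kernel_complement[OF h(1,2) d] by metis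
    define \<phi> where "\<phi> = (\<lambda>k y. if k = 0 then g a - g (a - y)
      else (-1) ^ (k - 1) * (deriv ^^ (k - 1)) (deriv g) (a - y))"
    have "psd N (\<lambda>i j. \<phi> 0 (a - lift_kernel d h i j))"
    proof (rule psd_absolutely_monotone[where b = a and \<phi> = \<phi>])
      show "(\<phi> k has_real_derivative \<phi> (Suc k) y) (at y)" "0 \<le> \<phi> k y"
        if "0 \<le> y" "y < a" for k y
        unfolding \<phi>_def using that by (rule bernstein_reflect[OF g])+
      show "0 \<le> a - lift_kernel d h i j \<and> a - lift_kernel d h i j < a" if "i < N" "j < N" for i j
        using a(3)[OF that] lift_kernel_pos[of d h i j] d h(2)[OF that] by simp
    qed (use a(2) h(3) in \<open>simp_all add: lift_kernel_def\<close>)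
    then have "psd N (\<lambda>i j. g a - g (lift_kernel d h i j))" by (simp add: \<phi>_def)
    then have "0 \<le> qform N (\<lambda>i j. g a - g (lift_kernel d h i j)) c" by (simp add: psd_def)
    then show ?thesis using c by (simp add: qform_diff qform_const)
  qed
  have "(g \<longlongrightarrow> g x) (at_right x)" if "0 \<le> x" for x
  proof -
    have "(g \<longlongrightarrow> g x) (at x within {0..})"
      using g that by (auto simp: bernstein_function_def continuous_on_def)
    then show ?thesis
      by (rule tendsto_within_subset) (use that in auto)
  qed
  then have glim: "(g \<longlongrightarrow> g (h i j)) (at_right (h i j))" if "i < N" "j < N" for i j
    using h(2)[OF that] by simp
  have "((\<lambda>d. qform N (\<lambda>i j. g (lift_kernel d h i j)) c) \<longlongrightarrow> qform N (\<lambda>i j. g (h i j)) c)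
      (at_right 0)"
    by (intro tendsto_qform lift_kernel_tendsto[where q = g] h(2) glim)
  moreover have "\<forall>\<^sub>F d in at_right 0. qform N (\<lambda>i j. g (lift_kernel d h i j)) c \<le> 0"
    using eventually_at_right_less[of "0::real"] by (rule eventually_mono) (rule le)
  ultimately show "qform N (\<lambda>i j. g (h i j)) c \<le> 0"
    by (rule tendsto_upperbound) simp
qed

section \<open>The geodesic distance\<close>

lemma gbinomial_neg_half_sign: "0 \<le> (-1) ^ k * ((-1/2 :: real) gchoose k)"
proof -
  have "(-1) ^ k * ((-1/2 :: real) gchoose k) = pochhammer (1/2) k / fact k"
    by (simp add: gbinomial_pochhammer)
  also have "\<dots> \<ge> 0" by (simp add: pochhammer_nonneg)
  finally show ?thesis .
qed

text \<open>
  Termwise integration of the binomial series of \<open>1 / sqrt (1 - x\<^sup>2)\<close>.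
\<close>

lemma arcsin_sums:
  obtains b :: "nat \<Rightarrow> real" where "\<And>n. 0 \<le> b n"
    and "\<And>x. \<bar>x\<bar> < 1 \<Longrightarrow> (\<lambda>n. b n * x ^ n) sums arcsin x"
proof -
  define w where "w = (\<lambda>k. (-1) ^ k * ((-1/2 :: real) gchoose k))"
  define a where "a = (\<lambda>n. if even n then w (n div 2) else 0)"
  define b where "b = (\<lambda>n. if n = 0 then 0 else a (n - 1) / real n)"
  have w: "0 \<le> w k" for k
    unfolding w_def by (rule gbinomial_neg_half_sign)
  have a: "0 \<le> a n" for n using w by (simp add: a_def)
  have asums: "(\<lambda>n. a n * x ^ n) sums (1 / sqrt (1 - x\<^sup>2))" if x: "\<bar>x\<bar> < 1" for x :: real
  proof -
    have x2: "x\<^sup>2 < 1" using x by (simp add: abs_square_less_1)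
    then have "(\<lambda>k. ((-1/2) gchoose k) * (- (x\<^sup>2)) ^ k) sums (1 + - (x\<^sup>2)) powr (-1/2)"
      by (intro gen_binomial_real) simp
    also have "(\<lambda>k. ((-1/2) gchoose k) * (- (x\<^sup>2)) ^ k) = (\<lambda>k. a (2 * k) * x ^ (2 * k))"
      by (rule ext) (simp add: a_def w_def power_minus[of "x\<^sup>2"] power_mult)
    also have "(1 + - (x\<^sup>2)) powr (-1/2) = 1 / sqrt (1 - x\<^sup>2)"
      using x2 powr_minus_divide[of "1 - x\<^sup>2" "1/2"] by (simp add: powr_half_sqrt)
    finally show ?thesis
      by (subst (asm) sums_mono_reindex[of "\<lambda>k. 2 * k" "\<lambda>n. a n * x ^ n"])
         (auto simp: strict_mono_def a_def elim!: evenE)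
  qed
  have bsum: "summable (\<lambda>n. b n * x ^ n)" if x: "\<bar>x\<bar> < 1" for x
  proof -
    have "summable (\<lambda>n. b (Suc n) * x ^ Suc n)"
    proof (rule summable_comparison_test'[where N = 0])
      show "summable (\<lambda>n. a n * \<bar>x\<bar> ^ n)"
        using asums[of "\<bar>x\<bar>"] x by (auto dest: sums_summable)
      fix n
      have "a n / real (Suc n) \<le> a n" using a[of n] by (simp add: field_simps)
      moreover have "\<bar>x\<bar> ^ Suc n \<le> \<bar>x\<bar> ^ n" using x by (intro power_decreasing) auto
      ultimately have "a n / real (Suc n) * \<bar>x\<bar> ^ Suc n \<le> a n * \<bar>x\<bar> ^ n"
        using a[of n] by (intro mult_mono) auto
      then show "norm (b (Suc n) * x ^ Suc n) \<le> a n * \<bar>x\<bar> ^ n"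
        using a[of n] by (simp add: b_def abs_mult power_abs del: of_nat_Suc power_Suc)
    qed
    then show ?thesis by (subst (asm) summable_Suc_iff)
  qed
  have dif: "diffs b = a"
    by (rule ext) (simp add: diffs_def b_def del: of_nat_Suc)
  have eq: "(\<Sum>n. b n * x ^ n) = arcsin x" if x: "\<bar>x\<bar> < 1" for x
  proof -
    have D: "((\<lambda>z. (\<Sum>n. b n * z ^ n) - arcsin z) has_real_derivative 0) (at z within {-1<..<1})"
      if z: "z \<in> {-1<..<1}" for z
    proof -
      have "((\<lambda>z. \<Sum>n. b n * z ^ n) has_real_derivative (\<Sum>n. diffs b n * z ^ n)) (at z)"
        using z by (intro termdiffs_strong'[where K = 1] bsum) auto
      also have "(\<Sum>n. diffs b n * z ^ n) = inverse (sqrt (1 - z\<^sup>2))"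
        using asums[of z] z by (auto simp: dif sums_iff inverse_eq_divide)
      finally have S: "((\<lambda>z. \<Sum>n. b n * z ^ n) has_real_derivative inverse (sqrt (1 - z\<^sup>2))) (at z)" .
      have "(arcsin has_real_derivative inverse (sqrt (1 - z\<^sup>2))) (at z)"
        using z by (intro DERIV_arcsin) auto
      from has_field_derivative_at_within[OF DERIV_diff[OF S this]] show ?thesis by simp
    qed
    have "\<exists>k. \<forall>z\<in>{-1<..<1}. (\<Sum>n. b n * z ^ n) - arcsin z = k"
      using D by (intro has_field_derivative_zero_constant) auto
    then obtain k where k: "\<And>z. \<bar>z\<bar> < 1 \<Longrightarrow> (\<Sum>n. b n * z ^ n) - arcsin z = k"
      by (auto simp: abs_less_iff)
    have "(\<Sum>n. b n * 0 ^ n) = b 0" by (rule powser_zero)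
    then have "k = 0" using k[of 0] by (simp add: b_def)
    then show ?thesis using k[OF x] by simp
  qed
  show thesis
  proof
    show "0 \<le> b n" for n using a by (simp add: b_def)
    show "(\<lambda>n. b n * x ^ n) sums arcsin x" if "\<bar>x\<bar> < 1" for x
      using bsum[OF that] eq[OF that] by (auto simp: sums_iff)
  qed
qed

lemma sphere_inner_bounds:
  fixes x y :: "'a::real_inner"
  assumes "norm x = 1" "norm y = 1"
  shows "-1 \<le> x \<bullet> y" "x \<bullet> y \<le> 1"
  using Cauchy_Schwarz_ineq2[of x y] assms by auto

text \<open>
  The power series of \<open>arcsin\<close> is available inside the unit interval only, while
  the diagonal of the Gram matrix of unit vectors is \<open>1\<close>; hence the detour through \<open>r * (s i \<bullet> s j)\<close>
  with \<open>r\<close> tending to \<open>1\<close> from below.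
\<close>

lemma cnd_d_GC:
  fixes s :: "nat \<Rightarrow> 'a::real_inner"
  assumes s: "\<And>i. i < N \<Longrightarrow> norm (s i) = 1"
  shows "cnd N (\<lambda>i j. d_GC (s i) (s j))"
proof -
  have bd: "-1 \<le> s i \<bullet> s j" "s i \<bullet> s j \<le> 1" if "i < N" "j < N" for i j
    using sphere_inner_bounds[of "s i" "s j"] s that by auto
  obtain b :: "nat \<Rightarrow> real" where b: "\<And>n. 0 \<le> b n"
    and sums: "\<And>x. \<bar>x\<bar> < 1 \<Longrightarrow> (\<lambda>n. b n * x ^ n) sums arcsin x"
    using arcsin_sums by blast
  have gram: "psd N (\<lambda>i j. s i \<bullet> s j)"
    unfolding psd_def
  proof
    fix c
    have "qform N (\<lambda>i j. s i \<bullet> s j) c = (\<Sum>i<N. c i *\<^sub>R s i) \<bullet> (\<Sum>i<N. c i *\<^sub>R s i)"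
      unfolding qform_def inner_sum_left
      by (intro sum.cong refl) (simp add: inner_sum_right sum_distrib_left algebra_simps)
    then show "0 \<le> qform N (\<lambda>i j. s i \<bullet> s j) c" by simp
  qed
  have "psd N (\<lambda>i j. arcsin (s i \<bullet> s j))"
  proof (rule psd_limit)
    show "at_left (1::real) \<noteq> bot" by simp
    have "\<forall>\<^sub>F r in at_left 1. 0 < r \<and> r < (1::real)"
      using eventually_at_left_real[of 0 "1::real"] by (auto elim: eventually_mono)
    then show "\<forall>\<^sub>F r in at_left 1. psd N (\<lambda>i j. arcsin (r * (s i \<bullet> s j)))"
    proof (rule eventually_mono)
      fix r :: real assume r: "0 < r \<and> r < 1"
      show "psd N (\<lambda>i j. arcsin (r * (s i \<bullet> s j)))"
      proof (rule psd_power_series[OF _ _ b sums])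
        show "psd N (\<lambda>i j. r * (s i \<bullet> s j))"
          using gram r by (simp add: psd_def qform_scale)
        fix i j assume "i < N" "j < N"
        then have "\<bar>s i \<bullet> s j\<bar> \<le> 1" using bd by (simp add: abs_le_iff)
        then have "r * \<bar>s i \<bullet> s j\<bar> \<le> r * 1" using r by (intro mult_left_mono) auto
        then show "\<bar>r * (s i \<bullet> s j)\<bar> < 1" using r abs_mult_pos'[of r "s i \<bullet> s j"] by linarith
      qed (simp add: inner_commute)
    qed
    fix i j assume ij: "i < N" "j < N"
    have "((\<lambda>r. r * (s i \<bullet> s j)) \<longlongrightarrow> 1 * (s i \<bullet> s j)) (at_left 1)"
      by (intro tendsto_intros)
    moreover have "\<forall>\<^sub>F r in at_left 1. r * (s i \<bullet> s j) \<in> {-1..1}"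
      using \<open>\<forall>\<^sub>F r in at_left 1. 0 < r \<and> r < (1::real)\<close>
    proof (rule eventually_mono)
      fix r :: real assume r: "0 < r \<and> r < 1"
      have "\<bar>s i \<bullet> s j\<bar> \<le> 1" using bd ij by (simp add: abs_le_iff)
      then have "\<bar>r * (s i \<bullet> s j)\<bar> \<le> 1"
        using r mult_mono[of "\<bar>r\<bar>" 1 "\<bar>s i \<bullet> s j\<bar>" 1] by (simp add: abs_mult)
      then show "r * (s i \<bullet> s j) \<in> {-1..1}" by (simp add: abs_le_iff)
    qed
    ultimately show "((\<lambda>r. arcsin (r * (s i \<bullet> s j))) \<longlongrightarrow> arcsin (s i \<bullet> s j)) (at_left 1)"
      using bd[OF ij] by (intro continuous_on_tendsto_compose[OF continuous_on_arcsin']) auto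
  qed
  then show ?thesis
    using qform_cong[of N "\<lambda>i j. d_GC (s i) (s j)" "\<lambda>i j. pi / 2 - arcsin (s i \<bullet> s j)"]
    by (auto simp: cnd_def psd_def qform_diff qform_const d_GC_def arccos_arcsin_eq bd)
qed

section \<open>Variograms\<close>

lemma variogram_of_increment:
  assumes "variogram_of M Y \<gamma>"
  shows "\<gamma> (t - s) = 1/2 * prob_space.variance M (\<lambda>\<omega>. Y t \<omega> - Y s \<omega>)"
proof -
  have "\<gamma> (t - s) = 1/2 * prob_space.variance M (\<lambda>\<omega>. Y (s + (t - s)) \<omega> - Y s \<omega>)"
    using assms unfolding variogram_of_def by blast
  then show ?thesis by simp
qed

text \<open>
  For real numbers \<open>z i\<close> and weights of zero sum, \<open>\<Sum>i j. c i * c j * (z i - z j)\<^sup>2\<close> equals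
  \<open>-2 * (\<Sum>i. c i * z i)\<^sup>2\<close>. Applied pointwise to the centred process and integrated, this gives the
  claim. Only increments are square integrable, so the process is first anchored at time \<open>0\<close>.
\<close>

lemma variogram_cnd:
  assumes V: "variogram_of M Y \<gamma>"
  shows "cnd N (\<lambda>i j. \<gamma> (t i - t j))"
  unfolding cnd_def
proof (intro allI impI)
  fix c :: "nat \<Rightarrow> real" assume c: "(\<Sum>i<N. c i) = 0"
  interpret prob_space M using V by (simp add: variogram_of_def)
  define X where "X = (\<lambda>i \<omega>. Y (t i) \<omega> - Y 0 \<omega>)"
  define Z where "Z = (\<lambda>i \<omega>. X i \<omega> - expectation (X i))"
  have meas: "Y u \<in> borel_measurable M" for u using V by (simp add: variogram_of_def)
  have sq: "integrable M (\<lambda>\<omega>. (Y (v + u) \<omega> - Y v \<omega>)\<^sup>2)" for u v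
    using V by (simp add: variogram_of_def)
  have X: "integrable M (X i)" for i
  proof (rule square_integrable_imp_integrable)
    show "X i \<in> borel_measurable M"
      unfolding X_def by (intro borel_measurable_diff meas)
    show "integrable M (\<lambda>\<omega>. (X i \<omega>)\<^sup>2)"
      unfolding X_def using sq[of 0 "t i"] by simp
  qed
  have int: "integrable M (\<lambda>\<omega>. (Z i \<omega> - Z j \<omega>)\<^sup>2)" for i j
  proof -
    define m where "m = expectation (X i) - expectation (X j)"
    have "integrable M (\<lambda>\<omega>. (X i \<omega> - X j \<omega>)\<^sup>2)"
      using sq[of "t j" "t i - t j"] by (simp add: X_def)
    then have "integrable M (\<lambda>\<omega>. (X i \<omega> - X j \<omega>)\<^sup>2 - 2 * m * (X i \<omega> - X j \<omega>) + m\<^sup>2)"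
      using X by simp
    also have "(\<lambda>\<omega>. (X i \<omega> - X j \<omega>)\<^sup>2 - 2 * m * (X i \<omega> - X j \<omega>) + m\<^sup>2)
        = (\<lambda>\<omega>. (Z i \<omega> - Z j \<omega>)\<^sup>2)"
      by (rule ext) (simp add: Z_def m_def power2_eq_square algebra_simps)
    finally show ?thesis .
  qed
  have gam: "\<gamma> (t i - t j) = 1/2 * expectation (\<lambda>\<omega>. (Z i \<omega> - Z j \<omega>)\<^sup>2)" for i j
  proof -
    have "\<gamma> (t i - t j) = 1/2 * variance (\<lambda>\<omega>. Y (t i) \<omega> - Y (t j) \<omega>)"
      by (rule variogram_of_increment[OF V])
    also have "(\<lambda>\<omega>. Y (t i) \<omega> - Y (t j) \<omega>) = (\<lambda>\<omega>. X i \<omega> - X j \<omega>)"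
      by (simp add: X_def)
    finally show ?thesis
      using X by (simp add: Z_def algebra_simps)
  qed
  have pt: "(\<Sum>i<N. \<Sum>j<N. c i * c j * (Z i \<omega> - Z j \<omega>)\<^sup>2) \<le> 0" for \<omega>
  proof -
    have "(\<Sum>i<N. \<Sum>j<N. c i * c j * (Z i \<omega> - Z j \<omega>)\<^sup>2)
      = (\<Sum>i<N. \<Sum>j<N. (c i * (Z i \<omega>)\<^sup>2) * c j + c i * (c j * (Z j \<omega>)\<^sup>2)
           - 2 * ((c i * Z i \<omega>) * (c j * Z j \<omega>)))"
      by (intro sum.cong refl) (simp add: power2_eq_square algebra_simps)
    also have "\<dots> = (\<Sum>i<N. c i * (Z i \<omega>)\<^sup>2) * (\<Sum>j<N. c j) + (\<Sum>i<N. c i) * (\<Sum>j<N. c j * (Z j \<omega>)\<^sup>2)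
           - 2 * ((\<Sum>i<N. c i * Z i \<omega>) * (\<Sum>j<N. c j * Z j \<omega>))"
      by (simp only: sum_subtractf sum.distrib sum_distrib_left[symmetric] sum_distrib_right[symmetric])
    also have "\<dots> = - 2 * (\<Sum>i<N. c i * Z i \<omega>)\<^sup>2"
      using c by (simp add: power2_eq_square)
    finally show ?thesis by simp
  qed
  have "qform N (\<lambda>i j. \<gamma> (t i - t j)) c
      = 1/2 * expectation (\<lambda>\<omega>. \<Sum>i<N. \<Sum>j<N. c i * c j * (Z i \<omega> - Z j \<omega>)\<^sup>2)"
    unfolding qform_def gam using int
    by (simp add: Bochner_Integration.integral_sum sum_distrib_left algebra_simps)
  also have "\<dots> \<le> 0"
    using integral_mono[of M "\<lambda>\<omega>. \<Sum>i<N. \<Sum>j<N. c i * c j * (Z i \<omega> - Z j \<omega>)\<^sup>2" "\<lambda>_. 0"] int pt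
    by (simp add: Bochner_Integration.integrable_sum)
  finally show "qform N (\<lambda>i j. \<gamma> (t i - t j)) c \<le> 0" .
qed

lemma variogram_zero: "variogram_of M Y \<gamma> \<Longrightarrow> \<gamma> 0 = 0"
  using variogram_of_increment[of M Y \<gamma> 0 0] by simp

section \<open>Right continuity of the generator at the origin\<close>

lemma completely_monotonic_isCont:
  assumes "completely_monotonic f" "0 < t"
  shows "isCont f t"
  using DERIV_isCont[OF completely_monotonic_DERIV[OF assms, of 0]] by simp

lemma completely_monotonic_antimono:
  assumes f: "completely_monotonic f" and x: "0 < x" "x \<le> y"
  shows "f y \<le> f x"
proof (rule DERIV_nonpos_imp_nonincreasing[OF x(2)])
  fix t assume "x \<le> t" "t \<le> y"
  then have t: "0 < t" using x by simp
  have "0 \<le> (-1) ^ 1 * (deriv ^^ 1) f t"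
    using f t unfolding completely_monotonic_def by blast
  then show "\<exists>z. (f has_real_derivative z) (at t) \<and> z \<le> 0"
    using completely_monotonic_DERIV[OF f t, of 0] by auto
qed

text \<open>
  On the segment between \<open>x0\<close> and \<open>x1\<close> the points where \<open>f \<circ> g\<close> differs from \<open>f 0\<close> by at least \<open>e\<close>
  form a compact set on which \<open>g\<close> has no zero, hence a positive lower bound. By the intermediate
  value theorem every small \<open>w > 0\<close> is a value of \<open>g\<close> on this segment, and it must be taken outside
  that set.
\<close>

lemma right_continuous_if_zero_attained:
  fixes f g :: "real \<Rightarrow> real"
  assumes g: "continuous_on {0..} g" "\<And>x. 0 \<le> x \<Longrightarrow> 0 \<le> g x"
    and fg: "continuous_on {0..} (\<lambda>x. f (g x))"
    and x0: "0 \<le> x0" "g x0 = 0" and x1: "0 \<le> x1" "g x1 \<noteq> 0"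
  shows "(f \<longlongrightarrow> f 0) (at_right 0)"
proof (rule tendstoI)
  fix e :: real assume e: "0 < e"
  define S where "S = closed_segment x0 x1"
  have S: "S \<subseteq> {0..}" "compact S" "connected S" "x0 \<in> S" "x1 \<in> S"
    using x0 x1 by (auto simp: S_def closed_segment_eq_real_ivl)
  have gS: "continuous_on S g" and fgS: "continuous_on S (\<lambda>x. f (g x))"
    using g(1) fg S(1) by (auto intro: continuous_on_subset)
  define K where "K = {x \<in> S. e \<le> dist (f (g x)) (f 0)}"
  have "closedin (top_of_set S) K"
    using continuous_closedin_preimage[of S "\<lambda>x. dist (f (g x)) (f 0)" "{e..}"] fgS
    by (simp add: K_def vimage_def Int_def continuous_on_dist)
  then have K: "compact K" using S(2) closedin_compact by blast
  have "\<exists>m>0. \<forall>x\<in>K. m \<le> g x"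
  proof (cases "K = {}")
    case True
    then show ?thesis by (intro exI[of _ 1]) auto
  next
    case False
    have "continuous_on K g" using gS by (rule continuous_on_subset) (auto simp: K_def)
    then obtain z where z: "z \<in> K" "\<forall>x\<in>K. g z \<le> g x"
      using continuous_attains_inf[OF K False] by blast
    then have "g z \<noteq> 0" using e by (auto simp: K_def)
    moreover have "0 \<le> g z" using z S(1) g(2) by (auto simp: K_def)
    ultimately show ?thesis using z by (intro exI[of _ "g z"]) auto
  qed
  then obtain m where m: "0 < m" "\<And>x. x \<in> K \<Longrightarrow> m \<le> g x" by auto
  have gx1: "0 < g x1" using g(2)[OF x1(1)] x1(2) by simp
  have "connected (g ` S)" using gS S(3) by (rule connected_continuous_image)
  have "dist (f w) (f 0) < e" if w: "0 < w" "w < min m (g x1)" for w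
  proof -
    have "w \<in> g ` S"
      using \<open>connected (g ` S)\<close>
      by (rule connectedD_interval[of _ "g x0" "g x1"]) (use S(4,5) x0(2) w in auto)
    then obtain x where x: "x \<in> S" "w = g x" by auto
    then have "x \<notin> K" using m(2)[of x] w by auto
    then show ?thesis using x by (simp add: K_def)
  qed
  then show "\<forall>\<^sub>F w in at_right 0. dist (f w) (f 0) < e"
    using m(1) gx1 eventually_at_right_real[of 0 "min m (g x1)"] by (auto elim: eventually_mono)
qed

lemma covariance_function_le_zero:
  assumes "covariance_function C" "\<And>u. C (- u) = C u"
  shows "C u \<le> C 0"
proof -
  define t c :: "nat \<Rightarrow> real" where "t = (\<lambda>k. if k = 0 then u else 0)"
    and "c = (\<lambda>k. if k = 0 then 1 else -1)"
  have "0 \<le> (\<Sum>i<2. \<Sum>j<2. c i * c j * C (t i - t j))"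
    using assms(1) unfolding covariance_function_def by blast
  then have "0 \<le> 2 * C 0 - C u - C (- u)"
    by (simp add: numeral_2_eq_2 t_def c_def)
  then show ?thesis using assms(2)[of u] by simp
qed

text \<open>
  Here \<open>q\<close> is not assumed continuous, so the previous argument does not apply. Instead, \<open>C\<close> runs
  continuously from \<open>C u < f 0\<close> up to its maximum \<open>f 0\<close> and takes all values in between; hence \<open>f\<close>
  takes values arbitrarily close to \<open>f 0\<close> from below at positive points, and monotonicity of \<open>f\<close>
  on the positive axis does the rest.
\<close>

lemma right_continuous_if_composite_peaks_at_zero:
  fixes f C q :: "real \<Rightarrow> real"
  assumes f: "completely_monotonic f" "inj_on f {0..}"
    and C: "continuous_on UNIV C" "\<And>u. C u \<le> C 0"
    and q: "\<And>u. 0 \<le> q u" "\<And>u. C u = f (q u)" "q 0 = 0" "q u \<noteq> 0"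
  shows "(f \<longlongrightarrow> f 0) (at_right 0)"
proof (rule tendstoI)
  fix e :: real assume e: "0 < e"
  have qu: "0 < q u" using q(1)[of u] q(4) by simp
  have "f (q u) \<noteq> f 0"
    using f(2) qu by (auto dest: inj_onD)
  then have lt: "C u < f 0"
    using C(2)[of u] q(2)[of u] q(2)[of 0] q(3) by simp
  \<comment> \<open>Otherwise \<open>f\<close> would attain \<open>f 0\<close> a second time between \<open>x\<close> and \<open>q u\<close>.\<close>
  have below: "f x < f 0" if x: "0 < x" for x
  proof (rule ccontr)
    assume "\<not> f x < f 0"
    then have fx: "f 0 \<le> f x" by simp
    have "x < q u"
      using completely_monotonic_antimono[OF f(1) qu, of x] fx lt q(2)[of u] by (cases "x < q u") auto
    have "\<exists>z\<ge>x. z \<le> q u \<and> f z = f 0"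
    proof (rule IVT2)
      show "\<forall>z. x \<le> z \<and> z \<le> q u \<longrightarrow> isCont f z"
        using completely_monotonic_isCont[OF f(1)] x by auto
    qed (use fx lt q(2)[of u] \<open>x < q u\<close> in auto)
    then obtain z where "x \<le> z" "f z = f 0" by auto
    then show False using f(2) x by (auto dest: inj_onD)
  qed
  define y where "y = max ((C u + f 0) / 2) (f 0 - e / 2)"
  have y: "C u < y" "y < f 0" "f 0 - e < y" using lt e unfolding y_def max_def by simp_all
  have "connected (range C)"
    using C(1) connected_UNIV by (rule connected_continuous_image)
  then have "y \<in> range C"
    by (rule connectedD_interval[of _ "C u" "C 0"]) (rule rangeI | use y q(2)[of 0] q(3) in simp)+
  then obtain v where v: "f (q v) = y" using q(2) by auto
  have qv: "0 < q v" using v y(2) q(1)[of v] by (cases "q v = 0") auto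
  have "dist (f w) (f 0) < e" if w: "0 < w" "w < q v" for w
  proof -
    have "y \<le> f w" using completely_monotonic_antimono[OF f(1) w(1), of "q v"] w(2) v by simp
    then show ?thesis using below[OF w(1)] y(3) by (simp add: dist_real_def)
  qed
  then show "\<forall>\<^sub>F w in at_right 0. dist (f w) (f 0) < e"
    using eventually_at_right_real[OF qv] by (auto elim: eventually_mono)
qed

section \<open>The covariance function\<close>

lemma gen_inverse_inverts:
  assumes "inj_on f {0..}" "y \<in> f ` {0..}"
  shows "0 \<le> gen_inverse f y" "f (gen_inverse f y) = y"
  using the_inv_into_into[OF assms order_refl] f_the_inv_into_f[OF assms]
  by (auto simp: gen_inverse_def)

theorem theorem6p3:
  fixes f f1 C :: "real \<Rightarrow> real"
    and M :: "'w measure" and Y :: "real \<Rightarrow> 'w \<Rightarrow> real"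
    and n :: nat
  assumes f_pos: "\<And>t. t \<ge> 0 \<Longrightarrow> f t > 0"
    and f_cm: "completely_monotonic f"
    and f_inv: "inj_on f {0..}"
    and f1_cont: "continuous_on {0..} f1"
    and f1_range: "f1 ` {0..} \<subseteq> f ` {0..}"
    and f1_bernstein: "bernstein_function (gen_inverse f \<circ> f1)"
    and C_cont: "continuous_on UNIV C"
    and C_sym: "\<And>u. C (- u) = C u"
    and C_cov: "covariance_function C"
    and C_range: "range C \<subseteq> f ` {0..}"
    and C_variogram: "variogram_of M Y (gen_inverse f \<circ> C)"
    and n_pos: "n \<ge> 1"
    and dim: "CARD('n::finite) = n + 1"
  shows "geodesically_isotropic_covariance (sphere (0 :: real ^ 'n) 1)
           (\<lambda>d u. quasi_arithmetic_mean f (restrict f1 {0..pi} d) (C u))"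
proof -
  define g where "g = gen_inverse f \<circ> f1"
  define \<gamma> where "\<gamma> = gen_inverse f \<circ> C"
  have g: "0 \<le> g x" "f (g x) = f1 x" if "0 \<le> x" for x
    using gen_inverse_inverts[OF f_inv, of "f1 x"] f1_range that by (auto simp: g_def)
  have \<gamma>: "0 \<le> \<gamma> u" "C u = f (\<gamma> u)" for u
    using gen_inverse_inverts[OF f_inv subsetD[OF C_range rangeI[of C u]]] by (simp_all add: \<gamma>_def)
  have var: "variogram_of M Y \<gamma>" and bern: "bernstein_function g"
    using C_variogram f1_bernstein by (simp_all add: \<gamma>_def g_def)
  have \<gamma>_even: "\<gamma> (- u) = \<gamma> u" for u using C_sym by (simp add: \<gamma>_def)
  let ?\<psi> = "\<lambda>d u. quasi_arithmetic_mean f (restrict f1 {0..pi} d) (C u)"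
  have \<psi>: "?\<psi> d u = f ((g d + \<gamma> u) / 2)" if "d \<in> {0..pi}" for d u
    using that by (simp add: quasi_arithmetic_mean_def g_def \<gamma>_def add_divide_distrib)
  have dist: "d_GC s s' \<in> {0..pi}" if "norm s = 1" "norm s' = 1" for s s' :: "real ^ 'n"
    using sphere_inner_bounds[OF that] by (simp add: d_GC_def arccos_lbound arccos_ubound)
  have dist_commute: "d_GC s s' = d_GC s' s" for s s' :: "real ^ 'n"
    by (simp add: d_GC_def inner_commute)
  have main: "psd N (\<lambda>i j. ?\<psi> (d_GC (s i) (s j)) (t i - t j))"
    if s: "\<And>i. i < N \<Longrightarrow> norm (s i) = 1" for N and s :: "nat \<Rightarrow> real ^ 'n" and t
  proof -
    let ?d = "\<lambda>i j. d_GC (s i) (s j)"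
    define h where "h = (\<lambda>i j. (g (?d i j) + \<gamma> (t i - t j)) / 2)"
    have d: "0 \<le> ?d i j" if "i < N" "j < N" for i j
      using dist[OF s s, OF that] by simp
    have "cnd N (\<lambda>i j. g (?d i j))"
      using cnd_bernstein[OF bern cnd_d_GC[OF s]] d dist_commute by auto
    then have cnd: "cnd N h"
      unfolding h_def using variogram_cnd[OF var] by (rule cnd_average)
    have h0: "0 \<le> h i j" if "i < N" "j < N" for i j
      using g(1)[OF d[OF that]] \<gamma>(1)[of "t i - t j"] by (simp add: h_def)
    have hsym: "h i j = h j i" for i j
      using \<gamma>_even[of "t i - t j"] dist_commute[of "s i" "s j"] by (simp add: h_def)
    have "psd N (\<lambda>i j. f (h i j))"
    proof (cases "(\<forall>x\<ge>0. g x = 0) \<and> (\<forall>u. \<gamma> u = 0)")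
      case True
      then have "f (h i j) = f 0" if "i < N" "j < N" for i j
        unfolding h_def using d[OF that] by simp
      then have "psd N (\<lambda>i j. f (h i j)) = psd N (\<lambda>i j. f 0)" by (rule psd_cong)
      then show ?thesis using f_pos[of 0] by (simp add: psd_const)
    next
      case False
      have lim: "(f \<longlongrightarrow> f (h i j)) (at_right (h i j))" if ij: "i < N" "j < N" for i j
      proof (cases "h i j = 0")
        \<comment> \<open>A zero entry of \<open>h\<close> is a zero of \<open>g\<close>, and whichever of \<open>g\<close> and \<open>\<gamma>\<close> is not identically \<open>0\<close> makes \<open>f\<close> right continuous at \<open>0\<close>.\<close>
        case zero: True
        have gz: "g (?d i j) = 0"
          using zero g(1)[OF d[OF ij]] \<gamma>(1)[of "t i - t j"] by (simp add: h_def)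
        have "continuous_on {0..} g" using bern by (simp add: bernstein_function_def)
        moreover have "continuous_on {0..} (\<lambda>x. f (g x))"
          using f1_cont by (rule continuous_on_eq) (simp add: g(2))
        ultimately have "(f \<longlongrightarrow> f 0) (at_right 0)" if "0 \<le> x" "g x \<noteq> 0" for x
          using right_continuous_if_zero_attained[of g f "?d i j" x] g(1) d[OF ij] gz that by auto
        moreover have "(f \<longlongrightarrow> f 0) (at_right 0)" if "\<gamma> u \<noteq> 0" for u
          using right_continuous_if_composite_peaks_at_zero[OF f_cm f_inv C_cont
              covariance_function_le_zero[OF C_cov C_sym] \<gamma> variogram_zero[OF var] that] .
        ultimately show ?thesis using False zero by auto
      next
        case False
        then have "isCont f (h i j)"
          using h0[OF ij] by (intro completely_monotonic_isCont[OF f_cm]) simp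
        then show ?thesis
          unfolding isCont_def by (rule tendsto_within_subset) simp
      qed
      show ?thesis
        by (intro psd_completely_monotonic[where f = f and h = h] f_cm cnd h0 hsym lim)
    qed
    also have "psd N (\<lambda>i j. f (h i j)) = psd N (\<lambda>i j. ?\<psi> (?d i j) (t i - t j))"
      unfolding h_def by (intro psd_cong \<psi>[symmetric] dist s)
    finally show ?thesis .
  qed
  show ?thesis
    unfolding geodesically_isotropic_covariance_def
  proof (intro conjI ballI allI impI)
    fix s s' :: "real ^ 'n" and t t' :: real
    show "?\<psi> (d_GC s s') (t - t') = ?\<psi> (d_GC s' s) (t' - t)"
      using C_sym[of "t - t'"] by (simp add: dist_commute[of s s'])
  next
    fix N and s :: "nat \<Rightarrow> real ^ 'n" and t c :: "nat \<Rightarrow> real"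
    assume "\<forall>i<N. s i \<in> sphere 0 1"
    then show "0 \<le> (\<Sum>i<N. \<Sum>j<N. c i * c j * ?\<psi> (d_GC (s i) (s j)) (t i - t j))"
      using main[of N s t] by (simp add: psd_def qform_def)
  qed
qed

end
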